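(* Let $k\ge 2$ be an integer and let $T_k(x)=\sum_{n_1,\ldots,n_k\le x}\frac{(n_1,\ldots,n_k)}{[n_1,\ldots,n_k]}$. Then $$\beta_k:=\sum_{\substack{n_1,\ldots,n_k=1\\ (n_1,\ldots,n_k)=1}}^{\infty}\frac{1}{[n_1,\ldots,n_k]\max(n_1,\ldots,n_k)}=\frac{1}{\zeta(2)}\sum_{n_1,\ldots,n_k=1}^{\infty}\frac{1}{[n_1,\ldots,n_k]\max(n_1,\ldots,n_k)}$$ is finite, and as $x\to\infty$, $$T_k(x)=\beta_k x+O\left((\log x)^{2^k-2}\right).$$
   Context: $(n_1,\ldots,n_k)$ and $[n_1,\ldots,n_k]$ denote the greatest common divisor and least common multiple of positive integers $n_1,\ldots,n_k$; $\zeta$ is the Riemann zeta function; the sum defining $T_k(x)$ ranges over $k$-tuples of positive integers $\le x$. *)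

theory Defs
  imports "HOL-Analysis.Analysis" "HOL-Library.Landau_Symbols"
begin

text \<open>A \<open>k\<close>-tuple is an extensional function on the index set \<open>{..<k}\<close>.\<close>

definition tuples :: "nat \<Rightarrow> (nat \<Rightarrow> nat) set" where
  "tuples k = {..<k} \<rightarrow>\<^sub>E {1..}"

definition tuples_le :: "nat \<Rightarrow> real \<Rightarrow> (nat \<Rightarrow> nat) set" where
  "tuples_le k x = {..<k} \<rightarrow>\<^sub>E {m. 1 \<le> m \<and> real m \<le> x}"

definition tuple_gcd :: "nat \<Rightarrow> (nat \<Rightarrow> nat) \<Rightarrow> nat" where
  "tuple_gcd k n = Gcd (n ` {..<k})"

definition tuple_lcm :: "nat \<Rightarrow> (nat \<Rightarrow> nat) \<Rightarrow> nat" where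
  "tuple_lcm k n = Lcm (n ` {..<k})"

definition tuple_max :: "nat \<Rightarrow> (nat \<Rightarrow> nat) \<Rightarrow> nat" where
  "tuple_max k n = Max (n ` {..<k})"

definition T :: "nat \<Rightarrow> real \<Rightarrow> real" where
  "T k x = (\<Sum>n\<in>tuples_le k x. real (tuple_gcd k n) / real (tuple_lcm k n))"

definition beta_term :: "nat \<Rightarrow> (nat \<Rightarrow> nat) \<Rightarrow> real" where
  "beta_term k n = 1 / (real (tuple_lcm k n) * real (tuple_max k n))"

text \<open>As \<^const>\<open>infsum\<close> is \<open>0\<close> on families that are not summable, this value is only
  meaningful together with summability of the family.\<close>

definition beta_const :: "nat \<Rightarrow> real" where
  "beta_const k = (\<Sum>\<^sub>\<infinity>n\<in>{n \<in> tuples k. tuple_gcd k n = 1}. beta_term k n)"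

text \<open>The Riemann zeta function on the real half-line \<open>s > 1\<close>, where its Dirichlet series converges.\<close>

definition zeta :: "real \<Rightarrow> real" where
  "zeta s = (\<Sum>n. 1 / real (Suc n) powr s)"

end

theory Submission
  imports Defs "HOL-Computational_Algebra.Primes" "HOL-Real_Asymp.Real_Asymp"
begin

text \<open>
  Writing a tuple as \<open>d\<close> times a primitive tuple \<open>m\<close> (one with gcd \<open>1\<close>) gives
  \<open>T k x = (\<Sum>m. \<lfloor>x / max m\<rfloor> / lcm m)\<close> over primitive \<open>m\<close> with \<open>max m \<le> x\<close>. Everything then rests on
  the bound \<open>(1 + ln x) ^ (2 ^ k - 2)\<close> for the sum \<open>S x\<close> of \<open>1 / lcm m\<close> over these \<open>m\<close>: it controls the
  error made by dropping the integer parts and, by splitting dyadically according to \<open>max m\<close>, the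
  tail of the series for the constant. To bound \<open>S x\<close>, assign to each nonempty proper set \<open>J\<close> of
  indices the number \<open>D J\<close> in which a prime \<open>p\<close> occurs as often as there are \<open>l \<ge> 1\<close> with
  \<open>J = {i. p ^ l dvd m i}\<close>. Then \<open>m i\<close> is the product of the \<open>D J\<close> with \<open>i \<in> J\<close>, and \<open>lcm m\<close> is the
  product of all \<open>D J\<close>. Hence \<open>m\<close> is determined by \<open>2 ^ k - 2\<close> numbers \<open>D J \<le> x\<close>, and \<open>S x\<close> is at
  most the corresponding power of a harmonic sum.
\<close>

section \<open>Factorization of coprime families over index sets\<close>

text \<open>Induction on the product of the entries, stripping one prime layer at a time, so that
  multiplicities never have to be named. The set \<open>A\<close> itself is excluded because no
  prime divides every entry, and the empty set because it would contribute to no entry.\<close>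

lemma coprime_family_prod_factorization:
  fixes m :: "'a \<Rightarrow> nat"
  assumes "finite A" "\<And>i. i \<in> A \<Longrightarrow> m i > 0" "Gcd (m ` A) = 1"
  shows "\<exists>D. (\<forall>J. D J > (0::nat)) \<and>
    (\<forall>i\<in>A. m i = (\<Prod>J\<in>{J \<in> Pow A - {{}, A}. i \<in> J}. D J)) \<and>
    Lcm (m ` A) = (\<Prod>J\<in>Pow A - {{}, A}. D J)"
  using assms(2,3)
proof (induction "\<Prod>i\<in>A. m i" arbitrary: m rule: less_induct)
  case less
  show ?case
  proof (cases "\<forall>i\<in>A. m i = 1")
    case True
    have "Lcm (m ` A) dvd 1"
      using True by (intro Lcm_least) auto
    then show ?thesis
      using True by (intro exI[of _ "\<lambda>_. 1"]) simp
  next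
    case False
    then obtain i0 where i0: "i0 \<in> A" "m i0 \<noteq> 1" by blast
    then obtain p where p: "prime p" "p dvd m i0"
      using prime_factor_nat by blast
    then have p0: "p > 0" "p > 1" using prime_gt_0_nat prime_gt_1_nat by blast+
    \<comment> \<open>Divide one factor \<open>p\<close> out of every \<open>m i\<close> it divides; this moves a factor \<open>p\<close> into \<open>D J0\<close>.\<close>
    define J0 where "J0 = {i\<in>A. p dvd m i}"
    have "J0 \<noteq> A"
    proof
      assume "J0 = A"
      then have "p dvd Gcd (m ` A)"
        by (intro Gcd_greatest) (auto simp: J0_def)
      then show False using less.prems(2) p by simp
    qed
    then have J0: "J0 \<in> Pow A - {{}, A}" using i0 p by (auto simp: J0_def)
    define m' where "m' i = (if i \<in> J0 then m i div p else m i)" for i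
    have m_J0: "m i = p * m' i" if "i \<in> J0" for i
      using that by (simp add: J0_def m'_def)
    have m_notJ0: "m' i = m i" if "i \<notin> J0" for i
      using that by (simp add: m'_def)
    have m'_dvd: "m' i dvd m i" for i
      by (cases "i \<in> J0") (simp_all add: m_J0 m_notJ0)
    have m'_pos: "m' i > 0" if "i \<in> A" for i
      by (rule dvd_pos_nat[OF less.prems(1)[OF that] m'_dvd])
    have "Gcd (m' ` A) dvd Gcd (m ` A)"
    proof (rule Gcd_greatest)
      fix a assume "a \<in> m ` A"
      then obtain i where "i \<in> A" "a = m i" by blast
      then show "Gcd (m' ` A) dvd a"
        using dvd_trans[OF Gcd_dvd m'_dvd[of i]] by blast
    qed
    then have gcd': "Gcd (m' ` A) = 1"
      using less.prems(2) by simp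
    have "(\<Prod>i\<in>A. m' i) < (\<Prod>i\<in>A. m i)"
    proof (rule prod_mono_strict[of i0])
      show "m' i0 < m i0"
        using m_J0[of i0] i0(1) p(2) p0(2) m'_pos[OF i0(1)] by (simp add: J0_def)
      show "0 \<le> m' i \<and> m' i \<le> m i" if "i \<in> A" for i
        using dvd_imp_le[OF m'_dvd less.prems(1)] that by auto
    qed (use assms i0 less.prems in auto)
    from less.hyps[OF this m'_pos gcd'] obtain D where D: "\<And>J. D J > 0"
      "\<And>i. i \<in> A \<Longrightarrow> m' i = (\<Prod>J\<in>{J \<in> Pow A - {{}, A}. i \<in> J}. D J)"
      "Lcm (m' ` A) = (\<Prod>J\<in>Pow A - {{}, A}. D J)" by blast
    define E where "E = D(J0 := p * D J0)"
    have prod_E: "prod E X = (if J0 \<in> X then p * prod D X else prod D X)" if "finite X" for X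
    proof (cases "J0 \<in> X")
      case True
      have "prod E (X - {J0}) = prod D (X - {J0})"
        by (rule prod.cong) (auto simp: E_def)
      then show ?thesis
        using True that by (simp add: prod.remove[of X J0] E_def)
    next
      case False
      then show ?thesis by (auto simp: E_def intro!: prod.cong)
    qed
    have lcm: "Lcm (m ` A) = p * Lcm (m' ` A)"
    proof (rule dvd_antisym)
      show "Lcm (m ` A) dvd p * Lcm (m' ` A)"
      proof (rule Lcm_least, clarify)
        fix i assume i: "i \<in> A"
        then have "m' i dvd Lcm (m' ` A)" by (intro dvd_Lcm) auto
        then show "m i dvd p * Lcm (m' ` A)"
          by (cases "i \<in> J0") (simp_all add: m_J0 m_notJ0)
      qed
      have "p dvd Lcm (m ` A)"
        using dvd_trans[OF p(2) dvd_Lcm[of "m i0" "m ` A"]] i0 by blast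
      \<comment> \<open>It remains to see that every \<open>m' i\<close> divides \<open>q\<close>:
        inside \<open>J0\<close> a factor \<open>p\<close> cancels, and outside \<open>J0\<close>
        the entry is coprime to \<open>p\<close>, so it divides the cofactor.\<close>
      then obtain q where q: "Lcm (m ` A) = p * q" by blast
      have "m' i dvd q" if "i \<in> A" for i
      proof (cases "i \<in> J0")
        case True
        have "m i dvd p * q" unfolding q[symmetric] using that by (intro dvd_Lcm) auto
        then show ?thesis using m_J0[OF True] p0 by simp
      next
        case False
        then have "coprime (m i) p"
          using that p by (simp add: J0_def prime_imp_coprime coprime_commute)
        moreover have "m i dvd p * q" unfolding q[symmetric] using that by (intro dvd_Lcm) auto
        ultimately show ?thesis using m_notJ0[OF False] by (simp add: coprime_dvd_mult_right_iff)
      qed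
      then have "Lcm (m' ` A) dvd q" by (intro Lcm_least) auto
      then show "p * Lcm (m' ` A) dvd Lcm (m ` A)" by (simp add: q)
    qed
    have "m i = prod E {J \<in> Pow A - {{}, A}. i \<in> J}" if "i \<in> A" for i
    proof (cases "i \<in> J0")
      case True
      then show ?thesis
        using D(2)[OF that] J0 assms(1) by (subst prod_E) (auto simp: m_J0)
    next
      case False
      then show ?thesis
        using D(2)[OF that] assms(1) m_notJ0[OF False] by (subst prod_E) auto
    qed
    moreover have "Lcm (m ` A) = prod E (Pow A - {{}, A})"
      using lcm D(3) J0 assms(1) by (subst prod_E) auto
    moreover have "\<forall>J. E J > 0" using D(1) p0 by (simp add: E_def)
    ultimately show ?thesis by blast
  qed
qed

section \<open>Harmonic sums and a convergent series\<close>

text \<open>The difference \<open>harm n - ln n\<close> is decreasing and equals 1 at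
  \<open>n = 1\<close>. The sequence in \<open>decseq_harm_diff_ln\<close> is indexed from 0, hence
  the \<open>n - 1\<close>.\<close>

lemma harm_le_one_plus_ln: "n > 0 \<Longrightarrow> (harm n :: real) \<le> 1 + ln (real n)"
  using decseqD[OF decseq_harm_diff_ln, of 0 "n - 1"] by (simp add: harm_def)

lemma sum_inverse_le_one_plus_ln:
  assumes "x \<ge> (1::real)"
  shows "(\<Sum>d\<in>{d::nat. 1 \<le> d \<and> real d \<le> x}. 1 / real d) \<le> 1 + ln x"
proof -
  define N where "N = nat \<lfloor>x\<rfloor>"
  have N: "N > 0" "real N \<le> x" using assms by (auto simp: N_def le_floor_iff)
  have "{d::nat. 1 \<le> d \<and> real d \<le> x} = {1..N}"
    using assms by (auto simp: N_def le_nat_floor nat_floor_neg le_nat_iff le_floor_iff)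
  then have "(\<Sum>d\<in>{d::nat. 1 \<le> d \<and> real d \<le> x}. 1 / real d) = harm N"
    by (simp add: harm_def inverse_eq_divide)
  also have "\<dots> \<le> 1 + ln (real N)" using N by (intro harm_le_one_plus_ln)
  also have "\<dots> \<le> 1 + ln x" using N by simp
  finally show ?thesis .
qed

text \<open>These are the weights of the dyadic blocks in the tail estimate; their sum is the
  constant there.\<close>

lemma summable_shift_power_over_power2:
  "summable (\<lambda>j. real (j + 2) ^ K / 2 ^ j)"
proof -
  \<comment> \<open>Any ratio strictly between 1/2 and 1 absorbs the polynomial factor; 3/4 is one
    choice.\<close>
  have "(\<lambda>j. real j ^ K * (1 / 2) ^ j) \<in> O(\<lambda>j. (3 / 4) ^ j)"
    by real_asymp
  then have "summable (\<lambda>j. real j ^ K * (1 / 2) ^ j)"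
    by (rule summable_comparison_test_bigo[rotated]) (auto intro: summable_geometric)
  \<comment> \<open>The factor 4 undoes the two extra halvings caused by shifting the index by
    2.\<close>
  then have "summable (\<lambda>j. 4 * (real (j + 2) ^ K * (1 / 2) ^ (j + 2)))"
    by (intro summable_mult) (subst summable_iff_shift)
  then show ?thesis
    by (simp add: power_one_over field_simps)
qed

section \<open>Primitive tuples: finiteness and positivity\<close>

definition primitive_tuples :: "nat \<Rightarrow> (nat \<Rightarrow> nat) set" where
  "primitive_tuples k = {n \<in> tuples k. tuple_gcd k n = 1}"

definition primitive_tuples_le :: "nat \<Rightarrow> real \<Rightarrow> (nat \<Rightarrow> nat) set" where
  "primitive_tuples_le k x = primitive_tuples k \<inter> tuples_le k x"

lemma finite_tuples_le: "finite (tuples_le k x)"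
proof -
  have "{m::nat. 1 \<le> m \<and> real m \<le> x} \<subseteq> {..nat \<lfloor>x\<rfloor>}"
    by (auto simp: le_nat_floor)
  then show ?thesis
    unfolding tuples_le_def by (intro finite_PiE) (auto intro: finite_subset)
qed

lemma finite_primitive_tuples_le: "finite (primitive_tuples_le k x)"
  by (simp add: primitive_tuples_le_def finite_tuples_le)

lemma tuples_le_iff:
  assumes "k > 0"
  shows "n \<in> tuples_le k x \<longleftrightarrow> n \<in> tuples k \<and> real (tuple_max k n) \<le> x"
proof -
  have "real (tuple_max k n) \<le> x \<longleftrightarrow> (\<forall>i<k. real (n i) \<le> x)"
  proof
    assume "real (tuple_max k n) \<le> x"
    moreover have "n i \<le> tuple_max k n" if "i < k" for i
      unfolding tuple_max_def using that by (intro Max_ge) auto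
    ultimately show "\<forall>i<k. real (n i) \<le> x"
      using of_nat_mono order_trans by blast
  next
    assume *: "\<forall>i<k. real (n i) \<le> x"
    have "tuple_max k n \<in> n ` {..<k}"
      unfolding tuple_max_def using assms by (intro Max_in) auto
    then show "real (tuple_max k n) \<le> x" using * by auto
  qed
  then show ?thesis
    by (auto simp: tuples_le_def tuples_def PiE_iff)
qed

lemma tuples_pos: "n \<in> tuples k \<Longrightarrow> i < k \<Longrightarrow> n i > 0"
  by (auto simp: tuples_def PiE_iff Suc_le_eq)

lemma tuple_max_pos:
  assumes "k > 0" "n \<in> tuples k"
  shows "tuple_max k n > 0"
proof -
  have "n 0 \<le> tuple_max k n"
    unfolding tuple_max_def using assms by (intro Max_ge) auto
  moreover have "n 0 \<ge> 1" using assms by (auto simp: tuples_def PiE_iff)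
  ultimately show ?thesis by simp
qed

lemma tuple_lcm_pos:
  assumes "n \<in> tuples k"
  shows "tuple_lcm k n > 0"
proof -
  have "tuple_lcm k n \<noteq> 0"
    unfolding tuple_lcm_def using tuples_pos[OF assms] by (subst Lcm_0_iff) force+
  then show ?thesis by simp
qed

lemma tuple_gcd_pos:
  assumes "k > 0" "n \<in> tuples k"
  shows "tuple_gcd k n > 0"
proof -
  have "n 0 \<in> n ` {..<k}" "n 0 \<noteq> 0" using tuples_pos[OF assms(2), of 0] assms by auto
  then have "tuple_gcd k n \<noteq> 0"
    unfolding tuple_gcd_def Gcd_0_iff by auto
  then show ?thesis by simp
qed

section \<open>Reciprocals of least common multiples of primitive tuples\<close>

lemma sum_inverse_lcm_primitive_le:
  assumes "k > 0" "x \<ge> 1"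
  shows "(\<Sum>n\<in>primitive_tuples_le k x. 1 / real (tuple_lcm k n)) \<le> (1 + ln x) ^ (2 ^ k - 2)"
proof -
  define P where "P = Pow {..<k} - {{}, {..<k}}"
  define I where "I = {d::nat. 1 \<le> d \<and> real d \<le> x}"
  define X where "X = primitive_tuples_le k x"
  have [simp]: "finite P" by (simp add: P_def)
  have "I \<subseteq> {..nat \<lfloor>x\<rfloor>}" by (auto simp: I_def le_nat_floor)
  then have [simp]: "finite I" by (rule finite_subset) simp
  have cardP: "card P = 2 ^ k - 2"
  proof -
    \<comment> \<open>The two excluded sets are distinct because \<open>k > 0\<close>.\<close>
    have "card {{}, {..<k}} = 2" using assms(1) by (auto simp: card_2_iff lessThan_empty_iff)
    then show ?thesis by (simp add: P_def card_Diff_subset card_Pow)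
  qed
  have "\<exists>D. (\<forall>J. D J > (0::nat)) \<and> (\<forall>i\<in>{..<k}. n i = (\<Prod>J\<in>{J \<in> P. i \<in> J}. D J)) \<and>
      tuple_lcm k n = (\<Prod>J\<in>P. D J)" if "n \<in> X" for n
    unfolding P_def tuple_lcm_def using that
    by (intro coprime_family_prod_factorization)
       (auto simp: X_def primitive_tuples_le_def primitive_tuples_def tuples_def tuple_gcd_def
          PiE_iff Suc_le_eq)
  then obtain D where D: "\<And>n J. n \<in> X \<Longrightarrow> D n J > (0::nat)"
    "\<And>n i. n \<in> X \<Longrightarrow> i < k \<Longrightarrow> n i = (\<Prod>J\<in>{J \<in> P. i \<in> J}. D n J)"
    "\<And>n. n \<in> X \<Longrightarrow> tuple_lcm k n = (\<Prod>J\<in>P. D n J)"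
    by (metis lessThan_iff)
  define \<Phi> where "\<Phi> n = restrict (D n) P" for n
  define g :: "(nat set \<Rightarrow> nat) \<Rightarrow> real" where "g e = (\<Prod>J\<in>P. 1 / real (e J))" for e
  \<comment> \<open>The entries are products of the values \<open>D n J\<close> with
    \<open>J \<in> P\<close>, so these values determine the tuple.\<close>
  have inj: "inj_on \<Phi> X"
  proof (rule inj_onI)
    fix n n' assume n: "n \<in> X" "n' \<in> X" "\<Phi> n = \<Phi> n'"
    have eq: "D n J = D n' J" if "J \<in> P" for J
      using fun_cong[OF n(3), of J] that by (simp add: \<Phi>_def)
    have "n i = n' i" if "i \<in> {..<k}" for i
      using that D(2)[OF n(1), of i] D(2)[OF n(2), of i] eq by simp
    then show "n = n'"
      by (intro extensionalityI[of n "{..<k}" n'])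
         (use n in \<open>auto simp: X_def primitive_tuples_le_def tuples_le_def PiE_iff\<close>)
  qed
  have "\<Phi> n \<in> P \<rightarrow>\<^sub>E I" if n: "n \<in> X" for n
  proof -
    \<comment> \<open>As \<open>J\<close> is nonempty, \<open>D n J\<close> divides some entry and
      is therefore at most \<open>x\<close>.\<close>
    have "D n J \<in> I" if J: "J \<in> P" for J
    proof -
      obtain i where i: "i \<in> J" "i < k" using J by (auto simp: P_def)
      have "D n J dvd n i"
        unfolding D(2)[OF n i(2)] using i J by (intro dvd_prodI) auto
      moreover have ni: "n i \<ge> 1" "real (n i) \<le> x"
        using n i by (auto simp: X_def primitive_tuples_le_def tuples_le_def PiE_iff)
      ultimately have "D n J \<le> n i" by (simp add: dvd_imp_le)
      then show ?thesis using ni D(1)[OF n, of J] by (simp add: I_def)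
    qed
    then show ?thesis by (simp add: \<Phi>_def)
  qed
  then have sub: "\<Phi> ` X \<subseteq> P \<rightarrow>\<^sub>E I" by blast
  have "(\<Sum>n\<in>X. 1 / real (tuple_lcm k n)) = (\<Sum>n\<in>X. g (\<Phi> n))"
    using D(3) by (intro sum.cong) (simp_all add: g_def \<Phi>_def prod_dividef)
  also have "\<dots> = sum g (\<Phi> ` X)" using inj by (simp add: sum.reindex)
  also have "\<dots> \<le> sum g (P \<rightarrow>\<^sub>E I)"
    using sub by (intro sum_mono2 finite_PiE) (auto simp: g_def intro!: prod_nonneg)
  \<comment> \<open>Distributivity: the sum over all choice functions of a product is the product
    over \<open>P\<close> of equal harmonic sums.\<close>
  also have "\<dots> = (\<Sum>d\<in>I. 1 / real d) ^ card P"
    unfolding g_def by (subst prod_sum_PiE[symmetric]) auto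
  also have "\<dots> \<le> (1 + ln x) ^ card P"
    unfolding I_def using assms(2)
    by (intro power_mono sum_inverse_le_one_plus_ln sum_nonneg) auto
  finally show ?thesis unfolding X_def cardP .
qed

section \<open>Splitting off the greatest common divisor\<close>

text \<open>The restriction keeps the result extensional, as membership in \<open>tuples k\<close>
  demands.\<close>

definition scale_tuple :: "nat \<Rightarrow> nat \<Rightarrow> (nat \<Rightarrow> nat) \<Rightarrow> nat \<Rightarrow> nat" where
  "scale_tuple k d m = (\<lambda>i\<in>{..<k}. d * m i)"

lemma image_scale_tuple: "scale_tuple k d m ` {..<k} = (*) d ` m ` {..<k}"
  by (auto simp: scale_tuple_def image_image)

lemma tuple_gcd_scale: "tuple_gcd k (scale_tuple k d m) = d * tuple_gcd k m"
  by (simp add: tuple_gcd_def image_scale_tuple Gcd_mult)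

lemma tuple_lcm_scale: "k > 0 \<Longrightarrow> tuple_lcm k (scale_tuple k d m) = d * tuple_lcm k m"
  by (simp add: tuple_lcm_def image_scale_tuple Lcm_mult lessThan_empty_iff)

lemma tuple_max_scale: "k > 0 \<Longrightarrow> tuple_max k (scale_tuple k d m) = d * tuple_max k m"
  unfolding tuple_max_def image_scale_tuple
  by (rule mono_Max_commute[symmetric]) (auto simp: mono_def lessThan_empty_iff)

text \<open>The inverse divides a tuple by its gcd. This reindexing serves both the finite sum
  \<open>T\<close> and the series over all tuples.\<close>

lemma bij_betw_scale_tuple:
  assumes "k > 0"
  shows "bij_betw (\<lambda>(m, d). scale_tuple k d m) (primitive_tuples k \<times> {1..}) (tuples k)"
proof (rule bij_betwI[where g = "\<lambda>n. (\<lambda>i\<in>{..<k}. n i div tuple_gcd k n, tuple_gcd k n)"])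
  show "(\<lambda>(m, d). scale_tuple k d m) \<in> primitive_tuples k \<times> {1..} \<rightarrow> tuples k"
    by (force simp: primitive_tuples_def tuples_def scale_tuple_def PiE_iff)
  have dvd: "tuple_gcd k n dvd n i" if "i < k" for n i
    unfolding tuple_gcd_def using that by (intro Gcd_dvd) auto
  have scale: "scale_tuple k (tuple_gcd k n) (\<lambda>i\<in>{..<k}. n i div tuple_gcd k n) = n"
    if "n \<in> tuples k" for n
    using that dvd by (auto simp: scale_tuple_def tuples_def PiE_iff extensional_def fun_eq_iff)
  then show "(case (\<lambda>i\<in>{..<k}. n i div tuple_gcd k n, tuple_gcd k n) of (m, d) \<Rightarrow>
      scale_tuple k d m) = n" if "n \<in> tuples k" for n
    using that by simp
  show "(\<lambda>n. (\<lambda>i\<in>{..<k}. n i div tuple_gcd k n, tuple_gcd k n)) \<in>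
      tuples k \<rightarrow> primitive_tuples k \<times> {1..}"
  proof (intro funcsetI SigmaI)
    fix n assume n: "n \<in> tuples k"
    have pos: "tuple_gcd k n > 0" using assms n by (rule tuple_gcd_pos)
    then show "tuple_gcd k n \<in> {1..}" by simp
    \<comment> \<open>Taking gcds on both sides of \<open>scale\<close> lets the positive factor
      \<open>tuple_gcd k n\<close> be cancelled.\<close>
    have "tuple_gcd k n = tuple_gcd k n * tuple_gcd k (\<lambda>i\<in>{..<k}. n i div tuple_gcd k n)"
      using tuple_gcd_scale[of k "tuple_gcd k n"] scale[OF n] by metis
    then have "tuple_gcd k (\<lambda>i\<in>{..<k}. n i div tuple_gcd k n) = 1"
      using pos by simp
    moreover have "n i div tuple_gcd k n > 0" if "i < k" for i
      using dvd[OF that, of n] pos tuples_pos[OF n that]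
      by (auto simp: div_greater_zero_iff intro!: dvd_imp_le)
    ultimately show "(\<lambda>i\<in>{..<k}. n i div tuple_gcd k n) \<in> primitive_tuples k"
      by (auto simp: primitive_tuples_def tuples_def PiE_iff Suc_le_eq)
  qed
  show "(\<lambda>i\<in>{..<k}. (case z of (m, d) \<Rightarrow> scale_tuple k d m) i div
      tuple_gcd k (case z of (m, d) \<Rightarrow> scale_tuple k d m),
      tuple_gcd k (case z of (m, d) \<Rightarrow> scale_tuple k d m)) = z"
    if z: "z \<in> primitive_tuples k \<times> {1..}" for z
  proof -
    obtain m d where z_eq: "z = (m, d)" by (cases z)
    have "d > 0" "tuple_gcd k m = 1" "m \<in> extensional {..<k}"
      using z by (auto simp: z_eq primitive_tuples_def tuples_def PiE_iff)
    moreover from this have "tuple_gcd k (scale_tuple k d m) = d"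
      by (simp add: tuple_gcd_scale)
    moreover have "(\<lambda>i\<in>{..<k}. scale_tuple k d m i div d) = m" if "d > 0" "m \<in> extensional {..<k}"
      using that by (auto simp: scale_tuple_def extensional_def fun_eq_iff)
    ultimately show ?thesis by (simp add: z_eq)
  qed
qed

section \<open>Reduction of \<open>T\<close> to a partial sum of the series\<close>

text \<open>For a tuple \<open>d\<close> times a primitive \<open>m\<close>, gcd over lcm is
  \<open>d / (d * lcm m) = 1 / lcm m\<close>, so \<open>d\<close> enters only through the number of
  its admissible values.\<close>

lemma T_eq_sum_primitive:
  assumes "k > 0"
  shows "T k x = (\<Sum>m\<in>primitive_tuples_le k x.
    real (card {d. 1 \<le> d \<and> real (d * tuple_max k m) \<le> x}) / real (tuple_lcm k m))"
proof -
  define D where "D m = {d. 1 \<le> d \<and> real (d * tuple_max k m) \<le> x}" for m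
  have prim: "m \<in> tuples k" "tuple_gcd k m = 1" "tuple_max k m > 0" "tuple_lcm k m > 0"
    if "m \<in> primitive_tuples_le k x" for m
    using that tuple_max_pos[OF assms] tuple_lcm_pos
    by (auto simp: primitive_tuples_le_def primitive_tuples_def)
  have fin: "finite (D m)" if m: "m \<in> primitive_tuples_le k x" for m
  proof (rule finite_subset)
    show "D m \<subseteq> {..nat \<lfloor>x\<rfloor>}"
    proof
      fix d assume "d \<in> D m"
      then have "real (d * tuple_max k m) \<le> x" by (simp add: D_def)
      moreover have "real d \<le> real (d * tuple_max k m)"
        using prim(3)[OF m] by (subst of_nat_le_iff) (simp add: Suc_le_eq)
      ultimately show "d \<in> {..nat \<lfloor>x\<rfloor>}" by (simp add: le_nat_floor)
    qed
  qed simp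
  let ?f = "\<lambda>(m, d). scale_tuple k d m"
  note bij = bij_betw_scale_tuple[OF assms]
  have sub: "Sigma (primitive_tuples_le k x) D \<subseteq> primitive_tuples k \<times> {1..}"
    by (auto simp: D_def primitive_tuples_le_def)
  \<comment> \<open>Limiting \<open>m\<close> to \<open>primitive_tuples_le k x\<close> loses
    nothing, since \<open>D m\<close> is empty once the maximum of \<open>m\<close> exceeds
    \<open>x\<close>.\<close>
  have img: "?f ` Sigma (primitive_tuples_le k x) D = tuples_le k x"
  proof (intro equalityI subsetI)
    fix n assume "n \<in> ?f ` Sigma (primitive_tuples_le k x) D"
    then obtain m d where md: "m \<in> primitive_tuples_le k x" "d \<in> D m" "n = scale_tuple k d m"
      by auto
    then have "n \<in> tuples k"
      using bij_betwE[OF bij] sub by fastforce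
    then show "n \<in> tuples_le k x"
      using md by (simp add: tuples_le_iff[OF assms] tuple_max_scale[OF assms] D_def)
  next
    fix n assume n: "n \<in> tuples_le k x"
    then have "n \<in> ?f ` (primitive_tuples k \<times> {1..})"
      using bij by (simp add: bij_betw_def tuples_le_iff[OF assms])
    then obtain m d where md: "m \<in> primitive_tuples k" "d \<ge> 1" "n = scale_tuple k d m"
      by auto
    have le: "real (d * tuple_max k m) \<le> x"
      using n md by (simp add: tuples_le_iff[OF assms] tuple_max_scale[OF assms])
    moreover have "real (tuple_max k m) \<le> real (d * tuple_max k m)"
      using md(2) by (subst of_nat_le_iff) simp
    ultimately have "m \<in> primitive_tuples_le k x"
      using md(1) by (simp add: primitive_tuples_le_def primitive_tuples_def tuples_le_iff[OF assms])
    with md le show "n \<in> ?f ` Sigma (primitive_tuples_le k x) D"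
      by (auto simp: D_def intro!: rev_image_eqI[of "(m, d)"])
  qed
  have bij': "bij_betw ?f (Sigma (primitive_tuples_le k x) D) (tuples_le k x)"
    using bij_betw_subset[OF bij sub img] .
  have "T k x = (\<Sum>z\<in>Sigma (primitive_tuples_le k x) D.
      real (tuple_gcd k (?f z)) / real (tuple_lcm k (?f z)))"
    unfolding T_def by (rule sum.reindex_bij_betw[OF bij', symmetric])
  also have "\<dots> = (\<Sum>(m, d)\<in>Sigma (primitive_tuples_le k x) D. 1 / real (tuple_lcm k m))"
    using prim by (intro sum.cong) (auto simp: tuple_gcd_scale tuple_lcm_scale[OF assms] D_def)
  also have "\<dots> = (\<Sum>m\<in>primitive_tuples_le k x. \<Sum>d\<in>D m. 1 / real (tuple_lcm k m))"
    using fin finite_primitive_tuples_le by (subst sum.Sigma) auto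
  finally show ?thesis by (simp add: D_def)
qed

text \<open>The count is the floor of \<open>x / M\<close>; as \<open>x \<ge> 0\<close>, the
  conversion by \<open>nat\<close> does not change it.\<close>

lemma card_multiples_bounds:
  assumes "M > 0" "x \<ge> 0"
  shows "real (card {d::nat. 1 \<le> d \<and> real (d * M) \<le> x}) \<le> x / real M"
    and "x / real M - 1 \<le> real (card {d::nat. 1 \<le> d \<and> real (d * M) \<le> x})"
proof -
  have le_iff: "real (d * M) \<le> x \<longleftrightarrow> d \<le> nat \<lfloor>x / real M\<rfloor>" for d
  proof -
    have "real (d * M) \<le> x \<longleftrightarrow> real d \<le> x / real M"
      using assms(1) by (simp add: pos_le_divide_eq)
    also have "\<dots> \<longleftrightarrow> int d \<le> \<lfloor>x / real M\<rfloor>"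
      by (simp only: le_floor_iff of_int_of_nat_eq)
    also have "\<dots> \<longleftrightarrow> d \<le> nat \<lfloor>x / real M\<rfloor>"
      using assms(2) by (subst le_nat_iff) auto
    finally show ?thesis .
  qed
  have "{d::nat. 1 \<le> d \<and> real (d * M) \<le> x} = {1..nat \<lfloor>x / real M\<rfloor>}"
    unfolding le_iff by auto
  then have "real (card {d::nat. 1 \<le> d \<and> real (d * M) \<le> x}) = of_int \<lfloor>x / real M\<rfloor>"
    using assms(2) by (simp only: card_atLeastAtMost) simp
  then show "real (card {d::nat. 1 \<le> d \<and> real (d * M) \<le> x}) \<le> x / real M"
    "x / real M - 1 \<le> real (card {d::nat. 1 \<le> d \<and> real (d * M) \<le> x})"
    by linarith+
qed

text \<open>Replacing each floor by its argument costs at most 1, weighted by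
  \<open>1 / lcm m\<close>; the weights are summed by
  \<open>sum_inverse_lcm_primitive_le\<close>.\<close>

lemma T_approx_sum_beta_term:
  assumes "k > 0" "x \<ge> 1"
  shows "\<bar>T k x - x * (\<Sum>m\<in>primitive_tuples_le k x. beta_term k m)\<bar> \<le> (1 + ln x) ^ (2 ^ k - 2)"
proof -
  let ?c = "\<lambda>m. real (card {d. 1 \<le> d \<and> real (d * tuple_max k m) \<le> x})"
  have "T k x - x * (\<Sum>m\<in>primitive_tuples_le k x. beta_term k m) =
      (\<Sum>m\<in>primitive_tuples_le k x. (?c m - x / real (tuple_max k m)) / real (tuple_lcm k m))"
    unfolding T_eq_sum_primitive[OF assms(1)] sum_distrib_left sum_subtractf[symmetric]
    by (intro sum.cong) (simp_all add: beta_term_def diff_divide_distrib mult.commute)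
  also have "\<bar>\<dots>\<bar> \<le> (\<Sum>m\<in>primitive_tuples_le k x. 1 / real (tuple_lcm k m))"
  proof (rule order_trans[OF sum_abs], rule sum_mono)
    fix m assume "m \<in> primitive_tuples_le k x"
    then have "tuple_max k m > 0"
      using tuple_max_pos[OF assms(1)] by (simp add: primitive_tuples_le_def primitive_tuples_def)
    from card_multiples_bounds[OF this, of x] assms(2)
    have "\<bar>?c m - x / real (tuple_max k m)\<bar> \<le> 1" by linarith
    then show "\<bar>(?c m - x / real (tuple_max k m)) / real (tuple_lcm k m)\<bar> \<le> 1 / real (tuple_lcm k m)"
      by (simp add: abs_divide divide_right_mono)
  qed
  also have "\<dots> \<le> (1 + ln x) ^ (2 ^ k - 2)"
    by (rule sum_inverse_lcm_primitive_le[OF assms])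
  finally show ?thesis .
qed

section \<open>Tail of the series and the error term\<close>

text \<open>In block \<open>j\<close> the maximum lies between \<open>2 ^ j * x\<close> and
  \<open>2 ^ (j + 1) * x\<close>: the lower bound controls the factor \<open>1 / max\<close>, the
  upper bound the sum of \<open>1 / lcm\<close>. Working with finite \<open>F\<close> lets one
  estimate give both summability and the size of the infinite tail.\<close>

lemma sum_beta_term_tail_le:
  assumes "k > 0" "x \<ge> 1" "finite F" "F \<subseteq> primitive_tuples k - primitive_tuples_le k x"
  shows "(\<Sum>m\<in>F. beta_term k m) \<le>
    (\<Sum>j. real (j + 2) ^ (2 ^ k - 2) / 2 ^ j) * (1 + ln x) ^ (2 ^ k - 2) / x"
proof -
  define K :: nat where "K = 2 ^ k - 2"
  \<comment> \<open>Index of the dyadic block. On \<open>F\<close> the maximum exceeds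
    \<open>x\<close>, so the logarithm is positive and \<open>nat\<close> truncates nothing.\<close>
  define lev where "lev m = nat \<lfloor>log 2 (real (tuple_max k m) / x)\<rfloor>" for m
  have F: "m \<in> primitive_tuples k" "m \<in> tuples k" "real (tuple_max k m) > x" if "m \<in> F" for m
  proof -
    have m: "m \<in> primitive_tuples k" "m \<notin> primitive_tuples_le k x"
      using assms(4) that by auto
    then show "m \<in> primitive_tuples k" "m \<in> tuples k"
      by (simp_all add: primitive_tuples_def)
    with m show "real (tuple_max k m) > x"
      by (simp add: primitive_tuples_le_def tuples_le_iff[OF assms(1)])
  qed
  have lev: "2 ^ lev m * x \<le> real (tuple_max k m)" "real (tuple_max k m) \<le> 2 ^ (lev m + 1) * x"
    if "m \<in> F" for m
  proof -
    let ?r = "real (tuple_max k m) / x"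
    have r: "?r > 1" using F(3)[OF that] assms(2) by simp
    then have "log 2 ?r \<ge> 0" by (subst zero_le_log_cancel_iff) auto
    then have l: "real (lev m) \<le> log 2 ?r" "log 2 ?r \<le> real (lev m + 1)"
      unfolding lev_def by linarith+
    have "2 powr real (lev m) \<le> ?r" using l(1) r by (subst (asm) le_log_iff) auto
    moreover have "?r \<le> 2 powr real (lev m + 1)" using l(2) r by (subst (asm) log_le_iff) auto
    ultimately show "2 ^ lev m * x \<le> real (tuple_max k m)"
      "real (tuple_max k m) \<le> 2 ^ (lev m + 1) * x"
      using assms(2) by (simp_all only: powr_realpow) (simp_all add: field_simps)
  qed
  have block: "(\<Sum>m\<in>{m\<in>F. lev m = j}. beta_term k m) \<le>
      (real (j + 2) ^ K / 2 ^ j) * ((1 + ln x) ^ K / x)" for j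
  proof -
    have "1 * 1 \<le> 2 ^ (j + 1) * x"
      using assms(2) by (intro mult_mono one_le_power) auto
    then have y: "2 ^ (j + 1) * x \<ge> 1" by (simp only: mult_1)
    have "(\<Sum>m\<in>{m\<in>F. lev m = j}. beta_term k m) \<le>
        (\<Sum>m\<in>{m\<in>F. lev m = j}. (1 / real (tuple_lcm k m)) * (1 / (2 ^ j * x)))"
    proof (rule sum_mono)
      fix m assume m: "m \<in> {m\<in>F. lev m = j}"
      have "1 / real (tuple_max k m) \<le> 1 / (2 ^ j * x)"
        using lev(1)[of m] m assms(2) by (intro divide_left_mono mult_pos_pos)
          (auto simp: tuple_max_pos[OF assms(1)] F)
      then have "(1 / real (tuple_lcm k m)) * (1 / real (tuple_max k m)) \<le>
          (1 / real (tuple_lcm k m)) * (1 / (2 ^ j * x))"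
        by (rule mult_left_mono) simp
      then show "beta_term k m \<le> (1 / real (tuple_lcm k m)) * (1 / (2 ^ j * x))"
        by (simp add: beta_term_def)
    qed
    also have "\<dots> = (\<Sum>m\<in>{m\<in>F. lev m = j}. 1 / real (tuple_lcm k m)) * (1 / (2 ^ j * x))"
      by (simp only: sum_distrib_right)
    also have "(\<Sum>m\<in>{m\<in>F. lev m = j}. 1 / real (tuple_lcm k m)) \<le>
        (\<Sum>m\<in>primitive_tuples_le k (2 ^ (j + 1) * x). 1 / real (tuple_lcm k m))"
      using F lev(2) finite_primitive_tuples_le
      by (intro sum_mono2) (auto simp: primitive_tuples_le_def tuples_le_iff[OF assms(1)])
    also have "\<dots> \<le> (1 + ln (2 ^ (j + 1) * x)) ^ K"
      unfolding K_def by (rule sum_inverse_lcm_primitive_le[OF assms(1) y])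
    \<comment> \<open>Separates \<open>j\<close> from \<open>x\<close>: with
      \<open>ln 2 < 1\<close>, the base is at most \<open>(j + 2) + ln x\<close>, hence at most
      \<open>(j + 2) * (1 + ln x)\<close>.\<close>
    also have "\<dots> \<le> (real (j + 2) * (1 + ln x)) ^ K"
    proof (rule power_mono)
      have "ln (2 ^ (j + 1) * x) = real (j + 1) * ln 2 + ln x"
        using assms(2) by (simp add: ln_mult ln_realpow del: power_Suc)
      also have "\<dots> \<le> real (j + 1) + ln x"
        using ln_2_less_1 by (intro add_right_mono) (simp add: mult_left_le)
      also have "1 + (real (j + 1) + ln x) \<le> real (j + 2) * (1 + ln x)"
        using mult_nonneg_nonneg[of "real (j + 1)" "ln x"] assms(2) by (simp add: algebra_simps)
      finally show "1 + ln (2 ^ (j + 1) * x) \<le> real (j + 2) * (1 + ln x)"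
        by simp
      show "0 \<le> 1 + ln (2 ^ (j + 1) * x)"
        using y ln_ge_zero by (simp add: add_nonneg_nonneg)
    qed
    finally show ?thesis
      using assms(2) by (simp add: power_mult_distrib mult.assoc divide_right_mono)
  qed
  have "(\<Sum>m\<in>F. beta_term k m) = (\<Sum>j\<in>lev ` F. \<Sum>m\<in>{m\<in>F. lev m = j}. beta_term k m)"
    using assms(3) by (rule sum.image_gen)
  also have "\<dots> \<le> (\<Sum>j\<in>lev ` F. (real (j + 2) ^ K / 2 ^ j) * ((1 + ln x) ^ K / x))"
    by (rule sum_mono) (rule block)
  also have "\<dots> = (\<Sum>j\<in>lev ` F. real (j + 2) ^ K / 2 ^ j) * ((1 + ln x) ^ K / x)"
    by (simp only: sum_distrib_right)
  \<comment> \<open>Passing from the occupied levels to all \<open>j\<close> makes the bound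
    independent of \<open>F\<close>.\<close>
  also have "\<dots> \<le> (\<Sum>j. real (j + 2) ^ K / 2 ^ j) * ((1 + ln x) ^ K / x)"
    using assms(2,3)
    by (intro mult_right_mono sum_le_suminf summable_shift_power_over_power2) auto
  finally show ?thesis unfolding K_def by simp
qed

lemma beta_term_nonneg: "beta_term k m \<ge> 0"
  by (simp add: beta_term_def)

text \<open>The tail estimate at \<open>x = 1\<close> bounds all finite sums of nonnegative terms
  outside a finite set.\<close>

lemma summable_beta_term_primitive:
  assumes "k > 0"
  shows "beta_term k summable_on primitive_tuples k"
proof -
  have "beta_term k summable_on (primitive_tuples k - primitive_tuples_le k 1)"
    by (rule nonneg_bounded_partial_sums_imp_summable_on[OF beta_term_nonneg])
       (use sum_beta_term_tail_le[OF assms order_refl] in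
         \<open>auto intro!: eventually_finite_subsets_at_top_weakI\<close>)
  moreover have "beta_term k summable_on primitive_tuples_le k 1"
    by (simp add: finite_primitive_tuples_le)
  ultimately have "beta_term k summable_on
      ((primitive_tuples k - primitive_tuples_le k 1) \<union> primitive_tuples_le k 1)"
    by (rule summable_on_Un_disjoint) auto
  moreover have "(primitive_tuples k - primitive_tuples_le k 1) \<union> primitive_tuples_le k 1 =
      primitive_tuples k"
    by (auto simp: primitive_tuples_le_def)
  ultimately show ?thesis by simp
qed

text \<open>The error splits into the floor error, at most \<open>L\<close>, and \<open>x\<close>
  times the tail, between 0 and \<open>C * L\<close>: the \<open>1 / x\<close> in the tail bound
  cancels the factor \<open>x\<close>.\<close>

lemma T_minus_beta_const_le:
  assumes "k > 0" "x \<ge> 1"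
  shows "\<bar>T k x - beta_const k * x\<bar> \<le>
    ((\<Sum>j. real (j + 2) ^ (2 ^ k - 2) / 2 ^ j) + 1) * (1 + ln x) ^ (2 ^ k - 2)"
proof -
  let ?A = "primitive_tuples k" and ?B = "primitive_tuples_le k x"
  define C where "C = (\<Sum>j. real (j + 2) ^ (2 ^ k - 2) / (2::real) ^ j)"
  define L where "L = (1 + ln x) ^ (2 ^ k - 2)"
  note sm = summable_beta_term_primitive[OF assms(1)]
  have sub: "?B \<subseteq> ?A" by (auto simp: primitive_tuples_le_def)
  have sm': "beta_term k summable_on (?A - ?B)"
    by (rule summable_on_subset_banach[OF sm]) auto
  have "beta_const k = infsum (beta_term k) ?A"
    by (simp add: beta_const_def primitive_tuples_def)
  also have "\<dots> = infsum (beta_term k) ?B + infsum (beta_term k) (?A - ?B)"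
    using infsum_Un_disjoint[of "beta_term k" ?B "?A - ?B"] sm' sub
    by (simp add: finite_primitive_tuples_le Un_absorb1)
  finally have beta: "beta_const k = sum (beta_term k) ?B + infsum (beta_term k) (?A - ?B)"
    by (simp add: finite_primitive_tuples_le)
  have "infsum (beta_term k) (?A - ?B) \<le> C * L / x"
    unfolding C_def L_def using sm' sum_beta_term_tail_le[OF assms]
    by (intro infsum_le_finite_sums)
  then have "x * infsum (beta_term k) (?A - ?B) \<le> C * L"
    using assms(2) by (simp add: field_simps)
  moreover have "x * infsum (beta_term k) (?A - ?B) \<ge> 0"
    using assms(2) by (intro mult_nonneg_nonneg infsum_nonneg beta_term_nonneg) auto
  moreover have "\<bar>T k x - x * sum (beta_term k) ?B\<bar> \<le> L"
    unfolding L_def by (rule T_approx_sum_beta_term[OF assms])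
  moreover have "T k x - beta_const k * x =
      (T k x - x * sum (beta_term k) ?B) - x * infsum (beta_term k) (?A - ?B)"
    unfolding beta by (simp add: algebra_simps)
  ultimately have "\<bar>T k x - beta_const k * x\<bar> \<le> C * L + L" by linarith
  then show ?thesis by (simp add: C_def L_def algebra_simps)
qed

section \<open>The series over all tuples and the factor \<open>zeta 2\<close>\<close>

text \<open>Recasts the ordered series defining \<open>zeta 2\<close> as an unordered sum over
  positive \<open>d\<close>, ready to be combined with the sum over primitive tuples.\<close>

lemma zeta_2_has_sum: "((\<lambda>d. 1 / real d ^ 2) has_sum zeta 2) {1..}"
proof -
  have "summable (\<lambda>n. 1 / real n ^ 2)"
    using inverse_power_summable[of 2, where 'a = real] by (simp add: inverse_eq_divide)
  then have "summable (\<lambda>n. 1 / real (Suc n) ^ 2)"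
    by (rule iffD2[OF summable_Suc_iff])
  then have "(\<lambda>n. 1 / real (Suc n) ^ 2) sums zeta 2"
    by (simp add: zeta_def summable_sums powr_numeral del: of_nat_Suc)
  then have "((\<lambda>n. 1 / real (Suc n) ^ 2) has_sum zeta 2) UNIV"
    by (rule sums_nonneg_imp_has_sum) simp
  moreover have "bij_betw Suc UNIV {1..}"
    by (rule bij_betwI[where g = "\<lambda>n. n - 1"]) auto
  ultimately show ?thesis
    using has_sum_reindex_bij_betw[of Suc UNIV "{1..}" "\<lambda>d. 1 / real d ^ 2"] by blast
qed

text \<open>The term \<open>d = 1\<close> alone contributes 1. Positivity permits the division by
  \<open>zeta 2\<close> in the final identity.\<close>

lemma zeta_2_pos: "zeta 2 > 0"
proof -
  have "(\<Sum>\<^sub>\<infinity>d\<in>{1}. 1 / real d ^ 2) \<le> (\<Sum>\<^sub>\<infinity>d\<in>{1..}. 1 / real d ^ 2)"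
    using zeta_2_has_sum by (intro infsum_mono_neutral) (auto simp: has_sum_imp_summable)
  then show ?thesis using infsumI[OF zeta_2_has_sum] by simp
qed

text \<open>Both lcm and maximum scale by \<open>d\<close>, so \<open>beta_term\<close> picks up
  \<open>1 / d ^ 2\<close> and the sum over pairs \<open>(m, d)\<close> factors.\<close>

lemma has_sum_beta_term_tuples:
  assumes "k > 0"
  shows "(beta_term k has_sum (beta_const k * zeta 2)) (tuples k)"
proof -
  let ?f = "\<lambda>(m, d). scale_tuple k d m"
  have prim: "(beta_term k has_sum beta_const k) (primitive_tuples k)"
    using has_sum_infsum[OF summable_beta_term_primitive[OF assms]]
    by (simp add: beta_const_def primitive_tuples_def)
  have "((\<lambda>(m, d). beta_term k m * (1 / real d ^ 2)) has_sum (beta_const k * zeta 2))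
      (primitive_tuples k \<times> {1..})"
  proof (rule has_sum_SigmaI)
    show "((\<lambda>d. case (m, d) of (m, d) \<Rightarrow> beta_term k m * (1 / real d ^ 2)) has_sum
        beta_term k m * zeta 2) {1..}" for m
      using has_sum_cmult_right[OF zeta_2_has_sum] by simp
    show "((\<lambda>m. beta_term k m * zeta 2) has_sum beta_const k * zeta 2) (primitive_tuples k)"
      by (rule has_sum_cmult_left[OF prim])
    \<comment> \<open>Joint summability follows from the iterated sums because all terms are
      nonnegative.\<close>
    show "(\<lambda>(m, d). beta_term k m * (1 / real d ^ 2)) summable_on primitive_tuples k \<times> {1..}"
    proof (rule summable_on_SigmaI)
      show "((\<lambda>d. case (m, d) of (m, d) \<Rightarrow> beta_term k m * (1 / real d ^ 2)) has_sum
          beta_term k m * zeta 2) {1..}" for m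
        using has_sum_cmult_right[OF zeta_2_has_sum] by simp
      show "(\<lambda>m. beta_term k m * zeta 2) summable_on primitive_tuples k"
        using has_sum_imp_summable[OF prim] by (rule summable_on_cmult_left)
    qed (auto simp: beta_term_nonneg)
  qed
  moreover have "(\<lambda>(m, d). beta_term k m * (1 / real d ^ 2)) = (\<lambda>z. beta_term k (?f z))"
    by (auto simp: beta_term_def tuple_lcm_scale[OF assms] tuple_max_scale[OF assms]
        power2_eq_square fun_eq_iff)
  ultimately show ?thesis
    using has_sum_reindex_bij_betw[OF bij_betw_scale_tuple[OF assms], of "beta_term k"] by simp
qed

theorem theorem7:
  fixes k :: nat
  assumes "k \<ge> 2"
  shows "beta_term k summable_on {n \<in> tuples k. tuple_gcd k n = 1}
    \<and> beta_term k summable_on tuples k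
    \<and> beta_const k = 1 / zeta 2 * (\<Sum>\<^sub>\<infinity>n\<in>tuples k. beta_term k n)
    \<and> (\<lambda>x::real. T k x - beta_const k * x) \<in> O[at_top](\<lambda>x. ln x ^ (2 ^ k - 2))"
proof (intro conjI)
  have k: "k > 0" using assms by simp
  show "beta_term k summable_on {n \<in> tuples k. tuple_gcd k n = 1}"
    using summable_beta_term_primitive[OF k] by (simp add: primitive_tuples_def)
  note all = has_sum_beta_term_tuples[OF k]
  show "beta_term k summable_on tuples k" using all by (rule has_sum_imp_summable)
  show "beta_const k = 1 / zeta 2 * (\<Sum>\<^sub>\<infinity>n\<in>tuples k. beta_term k n)"
    using infsumI[OF all] zeta_2_pos by simp
  define C where "C = (\<Sum>j. real (j + 2) ^ (2 ^ k - 2) / (2::real) ^ j) + 1"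
  have "(\<lambda>x. T k x - beta_const k * x) \<in> O(\<lambda>x. (1 + ln x) ^ (2 ^ k - 2))"
  proof (rule bigoI[of _ C])
    show "\<forall>\<^sub>F x in at_top. norm (T k x - beta_const k * x) \<le> C * norm ((1 + ln x) ^ (2 ^ k - 2))"
      using eventually_ge_at_top[of 1]
      by eventually_elim (use T_minus_beta_const_le[OF k] in \<open>simp add: C_def\<close>)
  qed
  \<comment> \<open>The added 1 is absorbed since \<open>1 + ln x\<close> is of order
    \<open>ln x\<close> at infinity.\<close>
  also have "(\<lambda>x::real. (1 + ln x) ^ (2 ^ k - 2)) \<in> O(\<lambda>x. ln x ^ (2 ^ k - 2))"
    by (rule landau_o.big_power) real_asymp
  finally show "(\<lambda>x. T k x - beta_const k * x) \<in> O(\<lambda>x. ln x ^ (2 ^ k - 2))" .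
qed

end
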